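(* Let $f:\mathbb{R}^n\to\mathbb{R}$ be continuously differentiable with gradient $g$ that is Lipschitz continuous on $\mathbb{R}^n$ with constant $L>0$, i.e. $\|g(x)-g(y)\|\le L\|x-y\|$ for all $x,y\in\mathbb{R}^n$. Let $0<\xi_1<1$, and let $\{x_k\}$ be generated by $x_{k+1}=x_k+\alpha_kd_k$ with $$d_k=\begin{cases}-g_k, & \text{if } k=0 \text{ or } \overline\omega_k>\xi_1,\\ u_kg_k+v_ks_{k-1}, & \text{otherwise,}\end{cases}$$ where $\overline\omega_k,u_k,v_k$ are as defined in the context and $\tau_k$ is any one of the three choices $\tau_k^{B}=\frac{s_{k-1}^Ty_{k-1}}{\|s_{k-1}\|^2}$, $\tau_k^{H}=\frac{\|y_{k-1}\|^2}{s_{k-1}^Ty_{k-1}}$, $\tau_k^{(1)}=1$. Assume $g_k\ne0$. If $s_{k-1}^Ty_{k-1}>0$, then $$g_k^Td_k<0.$$ Furthermore, if $f$ is uniformly convex, namely there exists $\mu>0$ such that $(g(x)-g(y))^T(x-y)\ge\mu\|x-y\|^2$ for all $x,y\in\mathbb{R}^n$, then there exists a constant $c>0$ (independent of $k$) such that $$g_k^Td_k<-c\|g_k\|^2 .$$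
   Context: Notation: $g_k=g(x_k)=\nabla f(x_k)$, $s_{k-1}=x_k-x_{k-1}$, $y_{k-1}=g_k-g_{k-1}$, $\|\cdot\|$ is the Euclidean norm, $\alpha_k>0$ is a stepsize, and $$\overline\omega_k=\frac{(g_k^Ts_{k-1})^2}{\|g_k\|^2\|s_{k-1}\|^2}.$$ For a scaling parameter $\tau_k>0$, $$u_k=\frac{1}{1-\overline\omega_k}\left(-1+\frac{g_k^Ty_{k-1}\,g_k^Ts_{k-1}}{s_{k-1}^Ty_{k-1}\|g_k\|^2}\right),$$ $$v_k=\frac{1-2\overline\omega_k}{1-\overline\omega_k}\,\frac{g_k^Ty_{k-1}}{s_{k-1}^Ty_{k-1}}-\left(\tau_k+\frac{\|y_{k-1}\|^2}{s_{k-1}^Ty_{k-1}}-\frac{s_{k-1}^Ty_{k-1}}{(1-\overline\omega_k)\|s_{k-1}\|^2}\right)\frac{g_k^Ts_{k-1}}{s_{k-1}^Ty_{k-1}}.$$ *)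

theory Defs
  imports "HOL-Analysis.Analysis"
begin

text \<open>Arguments named \<open>g\<close>, \<open>s\<close>, \<open>y\<close> of the first four definitions stand for the vectors
  $g_k$, $s_{k-1}$, $y_{k-1}$.\<close>

definition omega_bar :: "'a::real_inner \<Rightarrow> 'a \<Rightarrow> real" where
  "omega_bar g s = (g \<bullet> s)\<^sup>2 / ((norm g)\<^sup>2 * (norm s)\<^sup>2)"

definition u_coeff :: "'a::real_inner \<Rightarrow> 'a \<Rightarrow> 'a \<Rightarrow> real" where
  "u_coeff g s y =
     1 / (1 - omega_bar g s) * (- 1 + ((g \<bullet> y) * (g \<bullet> s)) / ((s \<bullet> y) * (norm g)\<^sup>2))"

definition v_coeff :: "real \<Rightarrow> 'a::real_inner \<Rightarrow> 'a \<Rightarrow> 'a \<Rightarrow> real" where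
  "v_coeff t g s y =
     (1 - 2 * omega_bar g s) / (1 - omega_bar g s) * ((g \<bullet> y) / (s \<bullet> y))
     - (t + (norm y)\<^sup>2 / (s \<bullet> y) - (s \<bullet> y) / ((1 - omega_bar g s) * (norm s)\<^sup>2))
       * ((g \<bullet> s) / (s \<bullet> y))"

definition scaling_choices :: "'a::real_inner \<Rightarrow> 'a \<Rightarrow> real set" where
  "scaling_choices s y = {(s \<bullet> y) / (norm s)\<^sup>2, (norm y)\<^sup>2 / (s \<bullet> y), 1}"

text \<open>For a sequence \<open>z\<close>, \<open>prev_diff z k\<close> is $z_k - z_{k-1}$, so that $s_{k-1}$ is
  \<open>prev_diff x k\<close> and $y_{k-1}$ is \<open>prev_diff (\<lambda>j. g (x j)) k\<close>. It is meaningful only for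
  \<open>k \<ge> 1\<close>: subtraction on \<open>nat\<close> truncates at \<open>k = 0\<close>.\<close>

definition prev_diff :: "(nat \<Rightarrow> 'a::real_inner) \<Rightarrow> nat \<Rightarrow> 'a" where
  "prev_diff z k = z k - z (k - 1)"

definition search_direction ::
  "real \<Rightarrow> (nat \<Rightarrow> real) \<Rightarrow> ('a::real_inner \<Rightarrow> 'a) \<Rightarrow> (nat \<Rightarrow> 'a) \<Rightarrow> nat \<Rightarrow> 'a" where
  "search_direction \<xi> \<tau> g x k =
     (let gk = g (x k); s = prev_diff x k; y = prev_diff (\<lambda>j. g (x j)) k
      in if k = 0 \<or> omega_bar gk s > \<xi> then - gk
         else u_coeff gk s y *\<^sub>R gk + v_coeff (\<tau> k) gk s y *\<^sub>R s)"

end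

theory Submission
  imports Defs
begin

text \<open>
  The coefficients \<open>u\<^sub>k\<close> and \<open>v\<^sub>k\<close> look complicated, but all factors \<open>1 - \<omega>\<^sub>k\<close> cancel in the inner
  product of the direction with the gradient: completing the square leaves
  \[ g^T d = - \| g - \frac{g^T s}{s^T y} y \|^2 - \tau \frac{(g^T s)^2}{s^T y} \]
  (lemma \<open>inner_direction_eq\<close>).  Both terms are nonpositive once \<open>s \<bullet> y > 0\<close> and \<open>\<tau> > 0\<close>, and they
  cannot both vanish: the second forces \<open>g \<bullet> s = 0\<close>, and then the first is \<open>-\<parallel>g\<parallel>\<^sup>2\<close>.

  For the uniform bound, split \<open>g\<close> as \<open>g - r y\<close> plus \<open>r y\<close> with \<open>r = (g \<bullet> s) / (s \<bullet> y)\<close>.  The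
  squared length of the first part is one of the two terms above, and that of the second is
  \<open>\<parallel>y\<parallel>\<^sup>2 / (\<tau> (s \<bullet> y))\<close> times the other.  So the descent is sufficient as soon as the ratio
  \<open>\<parallel>y\<parallel>\<^sup>2 / (\<tau> (s \<bullet> y))\<close> is bounded, and strong monotonicity together with the Lipschitz condition
  bounds it, for each admissible \<open>\<tau>\<close>, by a constant that depends only on \<open>L\<close> and \<open>\<mu>\<close>
  (lemma \<open>scaling_ratio_bound\<close>).  Restart steps \<open>d = - g\<close> satisfy \<open>g \<bullet> d = - \<parallel>g\<parallel>\<^sup>2\<close>, so any constant
  below \<open>1\<close> serves for them.
\<close>

lemma inner_direction_eq:
  fixes g s y :: "'a::real_inner"
  assumes "g \<noteq> 0" "s \<noteq> 0" "s \<bullet> y \<noteq> 0" and "omega_bar g s \<noteq> 1"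
  shows "g \<bullet> (u_coeff g s y *\<^sub>R g + v_coeff t g s y *\<^sub>R s)
       = - (norm (g - ((g \<bullet> s) / (s \<bullet> y)) *\<^sub>R y))\<^sup>2 - t * (g \<bullet> s)\<^sup>2 / (s \<bullet> y)"
proof -
  define w where "w = omega_bar g s"
  define p where "p = g \<bullet> s"
  define q where "q = g \<bullet> y"
  define a where "a = s \<bullet> y"
  define G where "G = (norm g)\<^sup>2"
  define S where "S = (norm s)\<^sup>2"
  define Y where "Y = (norm y)\<^sup>2"
  have nz: "G \<noteq> 0" "S \<noteq> 0" "a \<noteq> 0" "1 - w \<noteq> 0"
    using assms by (auto simp: G_def S_def a_def w_def)
  have p2: "p\<^sup>2 = w * G * S"
    using nz by (simp add: w_def omega_bar_def p_def G_def S_def)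
  have "g \<bullet> (u_coeff g s y *\<^sub>R g + v_coeff t g s y *\<^sub>R s) = u_coeff g s y * G + v_coeff t g s y * p"
    by (simp add: inner_add_right p_def G_def power2_norm_eq_inner)
  also have "\<dots> = (- G + p\<^sup>2 / S) / (1 - w) + (1 + (1 - 2 * w)) / (1 - w) * (q * p / a)
                  - (t + Y / a) * p\<^sup>2 / a"
  proof -
    have "u_coeff g s y * G = ((- 1 + q * p / (a * G)) * G) / (1 - w)"
      by (simp add: u_coeff_def w_def p_def q_def a_def G_def)
    also have "(- 1 + q * p / (a * G)) * G = - G + q * p / a"
      using nz by (simp add: field_simps)
    finally have "u_coeff g s y * G = - G / (1 - w) + 1 / (1 - w) * (q * p / a)"
      by (simp add: add_divide_distrib diff_divide_distrib)
    moreover have "(A * (q / a) - (T - a / (m * S)) * (p / a)) * p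
        = A * (q * p / a) - T * p\<^sup>2 / a + p\<^sup>2 / S / m" if "m \<noteq> 0" for A T m
      using nz that by (simp add: field_simps power2_eq_square)
    then have "v_coeff t g s y * p
        = (1 - 2 * w) / (1 - w) * (q * p / a) - (t + Y / a) * p\<^sup>2 / a + p\<^sup>2 / S / (1 - w)"
      unfolding v_coeff_def w_def[symmetric] p_def[symmetric] q_def[symmetric]
        a_def[symmetric] S_def[symmetric] Y_def[symmetric]
      using nz by blast
    moreover have "(- G / m + 1 / m * Q) + (A / m * Q - T + P / m)
        = (- G + P) / m + (1 + A) / m * Q - T" for m A P Q T :: real
      by (simp add: add_divide_distrib diff_divide_distrib distrib_right)
    ultimately show ?thesis by (simp only:)
  qed
  also have "(- G + p\<^sup>2 / S) / (1 - w) = - G"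
    using nz by (simp add: p2 field_simps)
  also have "(1 + (1 - 2 * w)) / (1 - w) = 2"
    using nz by (simp add: field_simps)
  also have "- G + 2 * (q * p / a) - (t + Y / a) * p\<^sup>2 / a
           = - (G - 2 * (p / a) * q + (p / a)\<^sup>2 * Y) - t * p\<^sup>2 / a"
    using nz by (simp add: field_simps power2_eq_square)
  also have "G - 2 * (p / a) * q + (p / a)\<^sup>2 * Y = (norm (g - (p / a) *\<^sub>R y))\<^sup>2"
    unfolding G_def Y_def q_def power2_norm_eq_inner
    by (simp add: inner_diff_left inner_diff_right inner_commute power2_eq_square)
  finally show ?thesis by (simp add: p_def a_def)
qed

lemma scaling_choices_pos:
  assumes "t \<in> scaling_choices s y" and "s \<bullet> y > 0"
  shows "t > 0"
proof -
  have "s \<noteq> 0" "y \<noteq> 0" using assms(2) by auto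
  then show ?thesis using assms by (auto simp: scaling_choices_def)
qed

lemma direction_descent:
  fixes g s y :: "'a::real_inner"
  assumes "g \<noteq> 0" and a: "s \<bullet> y > 0" and "omega_bar g s < 1" and t: "t > 0"
  shows "g \<bullet> (u_coeff g s y *\<^sub>R g + v_coeff t g s y *\<^sub>R s) < 0"
proof -
  have "s \<noteq> 0" using a by auto
  then have eq: "g \<bullet> (u_coeff g s y *\<^sub>R g + v_coeff t g s y *\<^sub>R s)
       = - (norm (g - ((g \<bullet> s) / (s \<bullet> y)) *\<^sub>R y))\<^sup>2 - t * (g \<bullet> s)\<^sup>2 / (s \<bullet> y)"
    using assms by (intro inner_direction_eq) auto
  show ?thesis
  proof (cases "g \<bullet> s = 0")
    case True
    then show ?thesis using \<open>g \<noteq> 0\<close> unfolding eq by simp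
  next
    case False
    then have "t * (g \<bullet> s)\<^sup>2 / (s \<bullet> y) > 0" using a t by simp
    moreover have "(norm (g - ((g \<bullet> s) / (s \<bullet> y)) *\<^sub>R y))\<^sup>2 \<ge> 0" by simp
    ultimately show ?thesis unfolding eq by linarith
  qed
qed

text \<open>
  This is \<open>\<parallel>v + w\<parallel>\<^sup>2 \<le> 2 \<parallel>v\<parallel>\<^sup>2 + 2 \<parallel>w\<parallel>\<^sup>2\<close>, applied to the splitting of \<open>g\<close> that the completed square
  suggests; \<open>M\<close> bounds the ratio by which the second part may exceed the \<open>t\<close>-term.
\<close>

lemma direction_sufficient_descent:
  fixes g s y :: "'a::real_inner"
  assumes "g \<noteq> 0" and a: "s \<bullet> y > 0" and "omega_bar g s < 1"
    and M: "1 \<le> M" "(norm y)\<^sup>2 \<le> M * (t * (s \<bullet> y))"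
  shows "(norm g)\<^sup>2 \<le> 2 * M * - (g \<bullet> (u_coeff g s y *\<^sub>R g + v_coeff t g s y *\<^sub>R s))"
proof -
  define r where "r = (g \<bullet> s) / (s \<bullet> y)"
  have "s \<noteq> 0" using a by auto
  then have eq: "- (g \<bullet> (u_coeff g s y *\<^sub>R g + v_coeff t g s y *\<^sub>R s))
       = (norm (g - r *\<^sub>R y))\<^sup>2 + t * (g \<bullet> s)\<^sup>2 / (s \<bullet> y)"
    using inner_direction_eq[of g s y t] assms by (simp add: r_def)
  have "(norm g)\<^sup>2 + (norm (g - 2 *\<^sub>R r *\<^sub>R y))\<^sup>2 = 2 * (norm (g - r *\<^sub>R y))\<^sup>2 + 2 * (norm (r *\<^sub>R y))\<^sup>2"
    unfolding power2_norm_eq_inner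
    by (simp add: inner_diff_left inner_diff_right inner_commute algebra_simps)
  then have "(norm g)\<^sup>2 \<le> 2 * (norm (g - r *\<^sub>R y))\<^sup>2 + 2 * (norm (r *\<^sub>R y))\<^sup>2"
    using zero_le_power2[of "norm (g - 2 *\<^sub>R r *\<^sub>R y)"] by linarith
  also have "(norm (r *\<^sub>R y))\<^sup>2 = r\<^sup>2 * (norm y)\<^sup>2"
    by (simp add: power_mult_distrib)
  also have "\<dots> \<le> r\<^sup>2 * (M * (t * (s \<bullet> y)))"
    using M(2) by (intro mult_left_mono) auto
  also have "\<dots> = M * (t * (g \<bullet> s)\<^sup>2 / (s \<bullet> y))"
    using a by (simp add: r_def power2_eq_square)
  also have "(norm (g - r *\<^sub>R y))\<^sup>2 \<le> M * (norm (g - r *\<^sub>R y))\<^sup>2"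
    using M(1) by (simp add: mult_le_cancel_right1)
  finally show ?thesis unfolding eq by (simp add: algebra_simps)
qed

text \<open>
  The three summands are bounds on \<open>\<parallel>y\<parallel>\<^sup>2 / (t (s \<bullet> y))\<close>, one for each admissible \<open>t\<close>: the second
  choice of \<open>t\<close> makes the ratio \<open>1\<close>, the unit choice bounds it by \<open>L\<^sup>2 / \<mu>\<close>, and the first by
  \<open>L\<^sup>2 / \<mu>\<^sup>2\<close>.
\<close>

lemma scaling_ratio_bound:
  fixes s y :: "'a::real_inner"
  assumes t: "t \<in> scaling_choices s y" and mu: "\<mu> > 0"
    and a: "s \<bullet> y > 0" and strong: "\<mu> * (norm s)\<^sup>2 \<le> s \<bullet> y"
    and lip: "norm y \<le> L * norm s"
  shows "(norm y)\<^sup>2 \<le> (1 + L\<^sup>2 / \<mu> + L\<^sup>2 / \<mu>\<^sup>2) * (t * (s \<bullet> y))"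
proof -
  have "s \<noteq> 0" using a by auto
  have tpos: "0 < t" using t a by (rule scaling_choices_pos)
  have Y: "(norm y)\<^sup>2 \<le> L\<^sup>2 * (norm s)\<^sup>2"
    using power_mono[OF lip norm_ge_zero, of 2] by (simp add: power_mult_distrib)
  have S: "(norm s)\<^sup>2 \<le> (s \<bullet> y) / \<mu>"
    using strong mu by (simp add: field_simps)
  have Ya: "(norm y)\<^sup>2 \<le> L\<^sup>2 / \<mu> * (s \<bullet> y)"
    using order_trans[OF Y mult_left_mono[OF S zero_le_power2]] by simp
  have widen: "K * (t * (s \<bullet> y)) \<le> (1 + L\<^sup>2 / \<mu> + L\<^sup>2 / \<mu>\<^sup>2) * (t * (s \<bullet> y))"
    if "K \<in> {1, L\<^sup>2 / \<mu>, L\<^sup>2 / \<mu>\<^sup>2}" for K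
    using that tpos a mu by (intro mult_right_mono) auto
  consider "t = (s \<bullet> y) / (norm s)\<^sup>2" | "t = (norm y)\<^sup>2 / (s \<bullet> y)" | "t = 1"
    using t by (auto simp: scaling_choices_def)
  then show ?thesis
  proof cases
    case 1
    have "\<mu> \<le> t" using 1 strong \<open>s \<noteq> 0\<close> by (simp add: pos_le_divide_eq)
    then have "L\<^sup>2 / \<mu> * (s \<bullet> y) * 1 \<le> L\<^sup>2 / \<mu> * (s \<bullet> y) * (t / \<mu>)"
      using mu a by (intro mult_left_mono) auto
    then have "(norm y)\<^sup>2 \<le> L\<^sup>2 / \<mu>\<^sup>2 * (t * (s \<bullet> y))"
      using Ya by (simp add: power2_eq_square mult_ac)
    then show ?thesis using widen[of "L\<^sup>2 / \<mu>\<^sup>2"] by auto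
  next
    case 2
    then have "(norm y)\<^sup>2 = 1 * (t * (s \<bullet> y))" using a by simp
    then show ?thesis using widen[of 1] by auto
  next
    case 3
    then show ?thesis using Ya widen[of "L\<^sup>2 / \<mu>"] by auto
  qed
qed

theorem lemma2p1:
  fixes f :: "real ^ 'n \<Rightarrow> real"
    and g :: "real ^ 'n \<Rightarrow> real ^ 'n"
    and x d :: "nat \<Rightarrow> real ^ 'n"
    and \<alpha> \<tau> :: "nat \<Rightarrow> real"
    and L \<xi>1 :: real
  assumes gradient: "\<And>z. GDERIV f z :> g z"
    and gradient_continuous: "continuous_on UNIV g"
    and L_pos: "L > 0"
    and gradient_Lipschitz: "L-lipschitz_on UNIV g"
    and xi: "0 < \<xi>1" "\<xi>1 < 1"
    and stepsize_pos: "\<And>k. \<alpha> k > 0"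
    and iterates: "\<And>k. x (Suc k) = x k + \<alpha> k *\<^sub>R d k"
    and direction: "\<And>k. d k = search_direction \<xi>1 \<tau> g x k"
    and scaling: "\<And>k. k \<ge> 1 \<Longrightarrow>
      \<tau> k \<in> scaling_choices (prev_diff x k) (prev_diff (\<lambda>j. g (x j)) k)"
  shows "(\<forall>k. g (x k) \<noteq> 0 \<longrightarrow>
            (k \<ge> 1 \<longrightarrow> prev_diff x k \<bullet> prev_diff (\<lambda>j. g (x j)) k > 0) \<longrightarrow>
            g (x k) \<bullet> d k < 0)
       \<and> ((\<exists>\<mu>>0. \<forall>a b. (g a - g b) \<bullet> (a - b) \<ge> \<mu> * (norm (a - b))\<^sup>2) \<longrightarrow>
            (\<exists>c>0. \<forall>k. g (x k) \<noteq> 0 \<longrightarrow> g (x k) \<bullet> d k < - c * (norm (g (x k)))\<^sup>2))"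
proof (intro conjI impI allI)
  fix k
  assume gk: "g (x k) \<noteq> 0"
    and pos: "k \<ge> 1 \<longrightarrow> prev_diff x k \<bullet> prev_diff (\<lambda>j. g (x j)) k > 0"
  show "g (x k) \<bullet> d k < 0"
  proof (cases "k = 0 \<or> omega_bar (g (x k)) (prev_diff x k) > \<xi>1")
    case True
    then show ?thesis using gk by (simp add: direction search_direction_def Let_def)
  next
    case False
    then have "k \<ge> 1" by simp
    have "\<tau> k > 0"
      using scaling[OF \<open>k \<ge> 1\<close>] pos \<open>k \<ge> 1\<close> by (blast intro: scaling_choices_pos)
    then show ?thesis
      using direction_descent[OF gk] pos \<open>k \<ge> 1\<close> False xi(2)
      by (simp add: direction search_direction_def Let_def)
  qed
next
  assume "\<exists>\<mu>>0. \<forall>a b. (g a - g b) \<bullet> (a - b) \<ge> \<mu> * (norm (a - b))\<^sup>2"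
  then obtain \<mu> where mu: "\<mu> > 0"
    and strong: "\<And>a b. (g a - g b) \<bullet> (a - b) \<ge> \<mu> * (norm (a - b))\<^sup>2" by blast
  define M where "M = 1 + L\<^sup>2 / \<mu> + L\<^sup>2 / \<mu>\<^sup>2"
  have M1: "M \<ge> 1" using mu by (simp add: M_def)
  have weak: "(norm (g (x k)))\<^sup>2 \<le> 2 * M * - (g (x k) \<bullet> d k)" if gk: "g (x k) \<noteq> 0" for k
  proof -
    define s where "s = prev_diff x k"
    define y where "y = prev_diff (\<lambda>j. g (x j)) k"
    have steepest: ?thesis if "d k = - g (x k)"
    proof -
      have "1 * (norm (g (x k)))\<^sup>2 \<le> 2 * M * (norm (g (x k)))\<^sup>2"
        using M1 by (intro mult_right_mono) auto
      then show ?thesis by (simp add: that power2_norm_eq_inner)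
    qed
    show ?thesis
    proof (cases "k = 0 \<or> omega_bar (g (x k)) s > \<xi>1")
      case True
      then show ?thesis
        by (intro steepest) (simp add: direction search_direction_def Let_def s_def)
    next
      case False
      then have k: "k \<ge> 1" and w: "omega_bar (g (x k)) s < 1" using xi(2) by auto
      have dk: "d k = u_coeff (g (x k)) s y *\<^sub>R g (x k) + v_coeff (\<tau> k) (g (x k)) s y *\<^sub>R s"
        using False by (simp add: direction search_direction_def Let_def s_def y_def)
      show ?thesis
      proof (cases "s = 0")
        \<comment> \<open>Here \<open>s \<bullet> y = 0\<close>, so the completed square is meaningless; but with \<open>a / 0 = 0\<close> the
          two-term formula is the steepest descent direction.\<close>
        case True
        then show ?thesis
          by (intro steepest) (simp add: dk u_coeff_def omega_bar_def)
      next
        case s: False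
        have st: "\<mu> * (norm s)\<^sup>2 \<le> s \<bullet> y"
          using strong[of "x k" "x (k - 1)"] by (simp add: s_def y_def prev_diff_def inner_commute)
        have a: "s \<bullet> y > 0"
          using st s mu by (smt (verit) mult_pos_pos zero_less_norm_iff zero_less_power)
        have lip: "norm y \<le> L * norm s"
          using lipschitz_onD[OF gradient_Lipschitz, of "x k" "x (k - 1)"]
          by (simp add: s_def y_def prev_diff_def dist_norm)
        have "(norm y)\<^sup>2 \<le> M * (\<tau> k * (s \<bullet> y))"
          unfolding M_def using scaling[OF k] mu a st lip
          by (intro scaling_ratio_bound) (auto simp: s_def y_def)
        then show ?thesis
          unfolding dk by (intro direction_sufficient_descent gk a w M1)
      qed
    qed
  qed
  show "\<exists>c>0. \<forall>k. g (x k) \<noteq> 0 \<longrightarrow> g (x k) \<bullet> d k < - c * (norm (g (x k)))\<^sup>2"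
  proof (intro exI[of _ "1 / (4 * M)"] conjI allI impI)
    show "1 / (4 * M) > 0" using M1 by simp
    fix k
    assume gk: "g (x k) \<noteq> 0"
    \<comment> \<open>Halving the constant \<open>1 / (2 * M)\<close> makes the inequality strict.\<close>
    have "(norm (g (x k)))\<^sup>2 < 2 * (2 * M * - (g (x k) \<bullet> d k))"
      using weak[OF gk] gk by (smt (verit) zero_less_norm_iff zero_less_power)
    then show "g (x k) \<bullet> d k < - (1 / (4 * M)) * (norm (g (x k)))\<^sup>2"
      using M1 by (simp add: field_simps)
  qed
qed

end
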